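(* Let $\mathscr{I}_{\infty}^{\nearrow}(\mathbb{N})$ be the semigroup of cofinite monotone partial bijections of $\mathbb{N}$, and let $E(\mathscr{I}_{\infty}^{\nearrow}(\mathbb{N}))$ be its set of idempotents. The following properties hold: (i) $\mathscr{I}_{\infty}^{\nearrow}(\mathbb{N})$ is a simple semigroup. (ii) For $\alpha,\beta\in\mathscr{I}_{\infty}^{\nearrow}(\mathbb{N})$, $\alpha\mathscr{R}\beta$ in $\mathscr{I}_{\infty}^{\nearrow}(\mathbb{N})$ if and only if $\operatorname{dom}\alpha=\operatorname{dom}\beta$, and $\alpha\mathscr{L}\beta$ in $\mathscr{I}_{\infty}^{\nearrow}(\mathbb{N})$ if and only if $\operatorname{ran}\alpha=\operatorname{ran}\beta$. (iii) For $\alpha,\beta\in\mathscr{I}_{\infty}^{\nearrow}(\mathbb{N})$, $\alpha\mathscr{H}\beta$ in $\mathscr{I}_{\infty}^{\nearrow}(\mathbb{N})$ if and only if $\alpha=\beta$. (iv) For every $\varepsilon,\iota\in E(\mathscr{I}_{\infty}^{\nearrow}(\mathbb{N}))$ there exists $\alpha\in\mathscr{I}_{\infty}^{\nearrow}(\mathbb{N})$ such that $\alpha\alpha^{-1}=\varepsilon$ and $\alpha^{-1}\alpha=\iota$. (v) $\mathscr{I}_{\infty}^{\nearrow}(\mathbb{N})$ is a bisimple semigroup. (vi) If $\varepsilon,\iota\in E(\mathscr{I}_{\infty}^{\nearrow}(\mathbb{N}))$, then $\varepsilon\leqslant\iota$ if and only if $\operatorname{dom}\varepsilon\subseteq\operatorname{dom}\iota$.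 (vii) The semilattice $E(\mathscr{I}_{\infty}^{\nearrow}(\mathbb{N}))$ is isomorphic to the semilattice $(\mathscr{P}_{<\omega}(\mathbb{N}),\cup)$ of all finite subsets of $\mathbb{N}$ under union, via the mapping $\varepsilon\mapsto\mathbb{N}\setminus\operatorname{dom}\varepsilon$. (viii) Every maximal chain in $E(\mathscr{I}_{\infty}^{\nearrow}(\mathbb{N}))$ is an $\omega$-chain.
   Context: $\mathbb{N}$ is the set of positive integers. $\mathscr{I}_{\infty}^{\nearrow}(\mathbb{N})$ is the set of all injective, order-preserving (hence strictly increasing) partial maps $\varphi\colon\mathbb{N}\rightharpoonup\mathbb{N}$ such that $\mathbb{N}\setminus\operatorname{dom}\varphi$ and $\mathbb{N}\setminus\operatorname{ran}\varphi$ are finite, where $\operatorname{ran}\varphi$ is the image of $\varphi$. The operation is composition of partial maps written on the right: $x(\alpha\beta)=(x\alpha)\beta$, with $\operatorname{dom}(\alpha\beta)=\{y\in\operatorname{dom}\alpha\mid y\alpha\in\operatorname{dom}\beta\}$. This is an inverse semigroup; $\alpha^{-1}$ is the inverse partial map. $\mathscr{R},\mathscr{L},\mathscr{H}$ are Green's relations. A semigroup is simple if it has no proper two-sided ideals, and bisimple if it consists of a single $\mathscr{D}$-class. For a semigroup $S$ with set of idempotents $E(S)$, the natural partial order on $E(S)$ is: $e\leqslant f$ if and only if $ef=fe=e$. A semilattice is a commutative semigroup of idempotents. A chain is a subset (subsemilattice) linearly ordered by the natural order; a maximal chain is a chain properly contained in no other chain. An $\omega$-chain is a chain order-isomorphic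 to $\{0,-1,-2,-3,\ldots\}$ with the usual order. *)

theory Defs
  imports "HOL-Algebra.Group"
begin

section \<open>Semigroups, Green's relations, idempotents\<close>

text \<open>
  A semigroup is carried by a \<^type>\<open>monoid_ext\<close> record, but none of the notions in this section
  refers to the field \<^term>\<open>one\<close>: the carrier is not assumed to contain an identity.
\<close>

definition is_semigroup :: "('a, 'b) monoid_scheme \<Rightarrow> bool" where
  "is_semigroup S \<longleftrightarrow>
     (\<forall>x\<in>carrier S. \<forall>y\<in>carrier S. x \<otimes>\<^bsub>S\<^esub> y \<in> carrier S) \<and>
     (\<forall>x\<in>carrier S. \<forall>y\<in>carrier S. \<forall>z\<in>carrier S.
        (x \<otimes>\<^bsub>S\<^esub> y) \<otimes>\<^bsub>S\<^esub> z = x \<otimes>\<^bsub>S\<^esub> (y \<otimes>\<^bsub>S\<^esub> z))"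

definition is_semilattice :: "('a, 'b) monoid_scheme \<Rightarrow> bool" where
  "is_semilattice S \<longleftrightarrow> is_semigroup S \<and>
     (\<forall>x\<in>carrier S. \<forall>y\<in>carrier S. x \<otimes>\<^bsub>S\<^esub> y = y \<otimes>\<^bsub>S\<^esub> x) \<and>
     (\<forall>x\<in>carrier S. x \<otimes>\<^bsub>S\<^esub> x = x)"

text \<open>As usual in semigroup theory, ideals are nonempty.\<close>

definition two_sided_ideal :: "('a, 'b) monoid_scheme \<Rightarrow> 'a set \<Rightarrow> bool" where
  "two_sided_ideal S I \<longleftrightarrow> I \<noteq> {} \<and> I \<subseteq> carrier S \<and>
     (\<forall>a\<in>I. \<forall>s\<in>carrier S. s \<otimes>\<^bsub>S\<^esub> a \<in> I \<and> a \<otimes>\<^bsub>S\<^esub> s \<in> I)"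

definition simple_semigroup :: "('a, 'b) monoid_scheme \<Rightarrow> bool" where
  "simple_semigroup S \<longleftrightarrow> is_semigroup S \<and> (\<forall>I. two_sided_ideal S I \<longrightarrow> I = carrier S)"

text \<open>The principal ideals \<open>a S\<^sup>1\<close> and \<open>S\<^sup>1 a\<close>, where \<open>S\<^sup>1\<close> is \<open>S\<close> with an identity adjoined.\<close>

definition right_ideal_gen :: "('a, 'b) monoid_scheme \<Rightarrow> 'a \<Rightarrow> 'a set" where
  "right_ideal_gen S a = insert a ((\<lambda>s. a \<otimes>\<^bsub>S\<^esub> s) ` carrier S)"

definition left_ideal_gen :: "('a, 'b) monoid_scheme \<Rightarrow> 'a \<Rightarrow> 'a set" where
  "left_ideal_gen S a = insert a ((\<lambda>s. s \<otimes>\<^bsub>S\<^esub> a) ` carrier S)"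

definition green_R :: "('a, 'b) monoid_scheme \<Rightarrow> 'a rel" where
  "green_R S = {(a, b) \<in> carrier S \<times> carrier S. right_ideal_gen S a = right_ideal_gen S b}"

definition green_L :: "('a, 'b) monoid_scheme \<Rightarrow> 'a rel" where
  "green_L S = {(a, b) \<in> carrier S \<times> carrier S. left_ideal_gen S a = left_ideal_gen S b}"

definition green_H :: "('a, 'b) monoid_scheme \<Rightarrow> 'a rel" where
  "green_H S = green_R S \<inter> green_L S"

text \<open>
  In every semigroup the relations \<open>\<R>\<close> and \<open>\<L>\<close> commute, so the order of composition is irrelevant
  and \<open>\<D>\<close> is the least equivalence relation containing both.
\<close>

definition green_D :: "('a, 'b) monoid_scheme \<Rightarrow> 'a rel" where
  "green_D S = green_R S O green_L S"

definition bisimple_semigroup :: "('a, 'b) monoid_scheme \<Rightarrow> bool" where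
  "bisimple_semigroup S \<longleftrightarrow> is_semigroup S \<and> (\<exists>C. carrier S // green_D S = {C})"

definition idempotents :: "('a, 'b) monoid_scheme \<Rightarrow> 'a set" where
  "idempotents S = {e \<in> carrier S. e \<otimes>\<^bsub>S\<^esub> e = e}"

definition natural_le :: "('a, 'b) monoid_scheme \<Rightarrow> 'a \<Rightarrow> 'a \<Rightarrow> bool" where
  "natural_le S e f \<longleftrightarrow> e \<otimes>\<^bsub>S\<^esub> f = e \<and> f \<otimes>\<^bsub>S\<^esub> e = e"

text \<open>
  Chains and maximal chains in \<open>E(S)\<close> are those of the library, \<^const>\<open>pred_on.chain\<close> and
  \<^const>\<open>pred_on.maxchain\<close>.
\<close>

definition is_omega_chain :: "('a, 'b) monoid_scheme \<Rightarrow> 'a set \<Rightarrow> bool" where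
  "is_omega_chain S C \<longleftrightarrow> pred_on.chain (idempotents S) (natural_le S) C \<and>
     (\<exists>h. bij_betw h C {k :: int. k \<le> 0} \<and>
          (\<forall>e\<in>C. \<forall>f\<in>C. natural_le S e f \<longleftrightarrow> h e \<le> h f))"

section \<open>Cofinite monotone partial bijections of the positive integers\<close>

definition pos_nats :: "nat set" where
  "pos_nats = {n. 1 \<le> n}"

definition cofin_mono_maps :: "(nat \<rightharpoonup> nat) set" where
  "cofin_mono_maps = {\<phi>.
     dom \<phi> \<subseteq> pos_nats \<and> ran \<phi> \<subseteq> pos_nats \<and>
     inj_on \<phi> (dom \<phi>) \<and> mono_on (dom \<phi>) (\<lambda>x. the (\<phi> x)) \<and>
     finite (pos_nats - dom \<phi>) \<and> finite (pos_nats - ran \<phi>)}"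

text \<open>
  Maps act on the right: the product of \<open>\<alpha>\<close> and \<open>\<beta>\<close> applies \<open>\<alpha>\<close> first, whereas
  \<^const>\<open>map_comp\<close> applies its second argument first.
\<close>

definition cofin_mono :: "(nat \<rightharpoonup> nat) monoid" where
  "cofin_mono = \<lparr>carrier = cofin_mono_maps,
                 monoid.mult = (\<lambda>\<alpha> \<beta>. \<beta> \<circ>\<^sub>m \<alpha>),
                 one = (\<lambda>x. if x \<in> pos_nats then Some x else None)\<rparr>"

definition partial_inv :: "('a \<rightharpoonup> 'b) \<Rightarrow> ('b \<rightharpoonup> 'a)" where
  "partial_inv \<alpha> = (\<lambda>y. if y \<in> ran \<alpha> then Some (THE x. \<alpha> x = Some y) else None)"

definition idempotent_semilattice :: "(nat \<rightharpoonup> nat) monoid" where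
  "idempotent_semilattice = cofin_mono\<lparr>carrier := idempotents cofin_mono\<rparr>"

definition finite_subsets_semilattice :: "nat set monoid" where
  "finite_subsets_semilattice =
     \<lparr>carrier = {A. A \<subseteq> pos_nats \<and> finite A}, monoid.mult = (\<union>), one = {}\<rparr>"

end

theory Submission
  imports Defs "HOL-Library.Infinite_Set"
begin

text \<open>
  An infinite set of natural numbers is listed in increasing order in exactly one way. Hence an
  element of \<^const>\<open>cofin_mono\<close> is determined by its domain and its range, and every pair of
  cofinite sets \<open>(D, F)\<close> occurs as domain and range (\<open>cofin_mono_maps_eqI\<close>, \<open>exists_transport\<close>).
  Write \<open>[D, F]\<close> for the element with domain \<open>D\<close> and range \<open>F\<close>. Then \<open>[D, F] [F, G] = [D, G]\<close>,
  since the two sides have the same domain and the same range; the inverse of \<open>[D, F]\<close> is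
  \<open>[F, D]\<close>; and the idempotents are the elements \<open>[D, D]\<close>, which are the identity maps of
  cofinite sets.

  The claims about Green's relations, simplicity and bisimplicity are read off from this
  multiplication rule. An element \<open>[D, F]\<close> is carried to any element with the same domain by a right
  factor, and to any element with the same range by a left factor, while in general a right factor
  cannot enlarge the domain and a left factor cannot enlarge the range. So \<open>\<R>\<close> compares domains,
  \<open>\<L>\<close> compares ranges, \<open>\<H>\<close> is trivial, and any \<open>[D, F]\<close> is \<open>\<D>\<close>-related to any \<open>[G, H]\<close> through
  \<open>[D, H]\<close>. An ideal containing \<open>[F, G]\<close> contains every \<open>[D, F] [F, G] [G, H] = [D, H]\<close>.

  The product of the identities of \<open>D\<close> and \<open>F\<close> is the identity of \<open>D \<inter> F\<close>, so taking complements
  turns the idempotents into the finite sets of positive integers under union, with the order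
  reversed. A maximal chain of finite subsets of an infinite set contains exactly one set of each
  cardinality (\<open>bij_betw_card_maximal_chain\<close>), so the negated cardinality of the
  complement identifies a maximal chain of idempotents with the nonpositive integers.
\<close>

section \<open>Maximal chains of finite sets\<close>

text \<open>
  Along a chain of finite sets, cardinality determines the set. If a set \<open>A\<close> of the chain had no
  successor of cardinality \<open>card A + 1\<close>, then a point outside \<open>A\<close>, chosen inside the next larger set
  of the chain if there is one, could be adjoined to \<open>A\<close> to obtain a set comparable with the whole
  chain, against maximality. No cardinality is skipped therefore, and the chain does not stop
  because \<open>X\<close> is infinite.
\<close>

lemma bij_betw_card_maximal_chain:
  assumes X: "infinite X"
    and fin: "\<And>A. A \<in> \<C> \<Longrightarrow> A \<subseteq> X \<and> finite A"
    and chain: "\<And>A B. A \<in> \<C> \<Longrightarrow> B \<in> \<C> \<Longrightarrow> A \<subseteq> B \<or> B \<subseteq> A"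
    and maximal: "\<And>A. A \<subseteq> X \<Longrightarrow> finite A \<Longrightarrow> (\<And>B. B \<in> \<C> \<Longrightarrow> A \<subseteq> B \<or> B \<subseteq> A) \<Longrightarrow> A \<in> \<C>"
  shows "bij_betw card \<C> UNIV"
proof -
  have inj: "inj_on card \<C>"
    by (intro inj_onI) (metis chain fin card_subset_eq)
  have "\<exists>A\<in>\<C>. card A = n" for n
  proof (induction n)
    case 0
    have "{} \<in> \<C>"
      by (intro maximal) auto
    then show ?case
      by (intro bexI[of _ "{}"]) auto
  next
    case (Suc n)
    then obtain A where A: "A \<in> \<C>" "card A = n"
      by blast
    have finA: "finite A" "A \<subseteq> X"
      using A fin by auto
    obtain x where x: "x \<in> X - A" "\<And>B. B \<in> \<C> \<Longrightarrow> A \<subset> B \<Longrightarrow> x \<in> B"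
    proof (cases "\<exists>B\<in>\<C>. A \<subset> B")
      case False
      moreover obtain x where "x \<in> X - A"
        using X finA by (metis Diff_eq_empty_iff equals0I finite_subset)
      ultimately show ?thesis
        by (intro that[of x]) auto
    next
      case True
      then obtain B\<^sub>0 where "B\<^sub>0 \<in> \<C> \<and> A \<subset> B\<^sub>0"
        by blast
      from ex_has_least_nat[of "\<lambda>B. B \<in> \<C> \<and> A \<subset> B", OF this, of card]
      obtain B where B: "B \<in> \<C>" "A \<subset> B" "\<And>B'. B' \<in> \<C> \<Longrightarrow> A \<subset> B' \<Longrightarrow> card B \<le> card B'"
        by auto
      have "B \<subseteq> B'" if B': "B' \<in> \<C>" "A \<subset> B'" for B'
        using chain[OF B(1) B'(1)]
      proof
        assume "B' \<subseteq> B"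
        then have "B' = B"
          using B(3)[OF B'] fin[OF B(1)] by (intro card_seteq) auto
        then show ?thesis
          by simp
      qed
      moreover obtain x where "x \<in> B" "x \<notin> A"
        using B(2) by blast
      moreover have "B \<subseteq> X"
        using fin[OF B(1)] by simp
      ultimately show ?thesis
        by (intro that[of x]) auto
    qed
    have "insert x A \<in> \<C>"
    proof (rule maximal)
      fix B assume B: "B \<in> \<C>"
      show "insert x A \<subseteq> B \<or> B \<subseteq> insert x A"
        using chain[OF A(1) B] x(2)[OF B] by blast
    qed (use finA x in auto)
    then show ?case
      using A finA x by (intro bexI[of _ "insert x A"]) auto
  qed
  then have "card ` \<C> = UNIV"
    by (metis UNIV_eq_I imageI)
  with inj show ?thesis
    by (simp add: bij_betw_def)
qed

section \<open>Cofinite monotone maps are pairs of cofinite sets\<close>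

lemma carrier_cofin_mono [simp]: "carrier cofin_mono = cofin_mono_maps"
  by (simp add: cofin_mono_def)

lemma mult_cofin_mono [simp]: "\<alpha> \<otimes>\<^bsub>cofin_mono\<^esub> \<beta> = \<beta> \<circ>\<^sub>m \<alpha>"
  by (simp add: cofin_mono_def)

lemma infinite_pos_nats: "infinite pos_nats"
proof -
  have "pos_nats = {1..}"
    by (auto simp: pos_nats_def)
  then show ?thesis
    using infinite_Ici[of "1::nat"] by simp
qed

definition cofinite_pos :: "nat set \<Rightarrow> bool" where
  "cofinite_pos D \<longleftrightarrow> D \<subseteq> pos_nats \<and> finite (pos_nats - D)"

lemma cofinite_pos_imp_infinite: "cofinite_pos D \<Longrightarrow> infinite D"
  unfolding cofinite_pos_def using infinite_pos_nats by (metis Diff_infinite_finite finite_Diff2)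

lemma cofinite_pos_Int: "cofinite_pos D \<Longrightarrow> cofinite_pos F \<Longrightarrow> cofinite_pos (D \<inter> F)"
  unfolding cofinite_pos_def by (auto simp: Diff_Int)

lemma cofinite_pos_Diff: "finite A \<Longrightarrow> cofinite_pos (pos_nats - A)"
  unfolding cofinite_pos_def by (auto simp: Diff_Diff_Int)

text \<open>Monotonicity and injectivity together amount to strict monotonicity, the form used below.\<close>

lemma cofin_mono_maps_iff:
  "\<alpha> \<in> cofin_mono_maps \<longleftrightarrow>
     cofinite_pos (dom \<alpha>) \<and> cofinite_pos (ran \<alpha>) \<and>
     (\<forall>x y a b. \<alpha> x = Some a \<longrightarrow> \<alpha> y = Some b \<longrightarrow> x < y \<longrightarrow> a < b)"
  (is "_ \<longleftrightarrow> ?R")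
proof
  assume \<alpha>: "\<alpha> \<in> cofin_mono_maps"
  have "a < b" if ab: "\<alpha> x = Some a" "\<alpha> y = Some b" and "x < y" for x y a b
  proof -
    have "a \<le> b"
      using \<alpha> that unfolding cofin_mono_maps_def mono_on_def
      by (metis (mono_tags, lifting) domI less_imp_le mem_Collect_eq option.sel)
    moreover have "a \<noteq> b"
      using \<alpha> that unfolding cofin_mono_maps_def
      by (metis (mono_tags, lifting) domI inj_onD less_irrefl mem_Collect_eq)
    ultimately show ?thesis
      by simp
  qed
  then show ?R
    using \<alpha> by (auto simp: cofin_mono_maps_def cofinite_pos_def)
next
  assume R: ?R
  then have less: "a < b" if "\<alpha> x = Some a" "\<alpha> y = Some b" "x < y" for x y a b
    using that by blast
  have "inj_on \<alpha> (dom \<alpha>)"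
  proof (rule inj_onI)
    fix x y assume "x \<in> dom \<alpha>" "y \<in> dom \<alpha>" "\<alpha> x = \<alpha> y"
    then obtain a where "\<alpha> x = Some a" "\<alpha> y = Some a"
      by auto
    then show "x = y"
      using less[of x a y a] less[of y a x a] by (cases x y rule: linorder_cases) auto
  qed
  moreover have "mono_on (dom \<alpha>) (\<lambda>x. the (\<alpha> x))"
  proof (rule mono_onI)
    fix x y assume "x \<in> dom \<alpha>" "y \<in> dom \<alpha>" "x \<le> y"
    then show "the (\<alpha> x) \<le> the (\<alpha> y)"
      using less[of x _ y] by (cases "x = y") (auto intro: less_imp_le)
  qed
  ultimately show "\<alpha> \<in> cofin_mono_maps"
    using R by (auto simp: cofin_mono_maps_def cofinite_pos_def)
qed

lemma cofin_mono_maps_dom: "\<alpha> \<in> cofin_mono_maps \<Longrightarrow> cofinite_pos (dom \<alpha>)"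
  and cofin_mono_maps_ran: "\<alpha> \<in> cofin_mono_maps \<Longrightarrow> cofinite_pos (ran \<alpha>)"
  and cofin_mono_maps_less:
    "\<alpha> \<in> cofin_mono_maps \<Longrightarrow> \<alpha> x = Some a \<Longrightarrow> \<alpha> y = Some b \<Longrightarrow> x < y \<Longrightarrow> a < b"
  by (auto simp: cofin_mono_maps_iff)

lemma cofin_mono_maps_inj:
  "\<alpha> \<in> cofin_mono_maps \<Longrightarrow> \<alpha> x = Some a \<Longrightarrow> \<alpha> y = Some a \<Longrightarrow> x = y"
  by (metis cofin_mono_maps_less less_irrefl linorder_neqE_nat)

text \<open>
  At the least point \<open>x\<close> where \<open>\<alpha>\<close> and \<open>\<beta>\<close> differ, neither value can be the smaller one: a value
  of \<open>\<alpha>\<close> below \<open>\<beta> x\<close> is taken by \<open>\<beta>\<close> at some \<open>y < x\<close>, where the two maps still agree, so \<open>\<alpha>\<close> would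
  take it twice.
\<close>

lemma cofin_mono_maps_eqI:
  assumes \<alpha>: "\<alpha> \<in> cofin_mono_maps" and \<beta>: "\<beta> \<in> cofin_mono_maps"
    and dom: "dom \<alpha> = dom \<beta>" and ran: "ran \<alpha> = ran \<beta>"
  shows "\<alpha> = \<beta>"
proof
  have not_less: "\<not> a < b"
    if maps: "\<phi> \<in> cofin_mono_maps" "\<psi> \<in> cofin_mono_maps" and ran: "ran \<phi> = ran \<psi>"
      and agree: "\<And>y. y < x \<Longrightarrow> \<phi> y = \<psi> y" and ab: "\<phi> x = Some a" "\<psi> x = Some b"
    for \<phi> \<psi> :: "nat \<rightharpoonup> nat" and x a b
  proof
    assume "a < b"
    obtain y where y: "\<psi> y = Some a"
      using ab(1) ran by (force simp: ran_def)
    then have "y < x"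
      using ab(2) \<open>a < b\<close> cofin_mono_maps_less[OF maps(2)]
      by (metis less_asym linorder_neqE_nat option.inject less_irrefl)
    then have "\<phi> y = Some a"
      using agree y by simp
    then show False
      using \<open>y < x\<close> ab(1) cofin_mono_maps_inj[OF maps(1)] by blast
  qed
  fix x
  show "\<alpha> x = \<beta> x"
  proof (induction x rule: less_induct)
    case (less x)
    show ?case
    proof (cases "x \<in> dom \<alpha>")
      case True
      then obtain a b where ab: "\<alpha> x = Some a" "\<beta> x = Some b"
        using dom by blast
      then have "\<not> a < b" "\<not> b < a"
        using not_less[OF \<alpha> \<beta> ran less.IH] not_less[OF \<beta> \<alpha> ran[symmetric]] less.IH by metis+
      with ab show ?thesis
        by simp
    next
      case False
      then show ?thesis
        using dom by (metis domIff)
    qed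
  qed
qed

lemma exists_transport:
  assumes D: "cofinite_pos D" and F: "cofinite_pos F"
  shows "\<exists>\<alpha>\<in>cofin_mono_maps. dom \<alpha> = D \<and> ran \<alpha> = F"
proof -
  have inf: "infinite D" "infinite F"
    using assms by (auto dest: cofinite_pos_imp_infinite)
  \<comment> \<open>The \<open>n\<close>-th element of \<open>D\<close> is sent to the \<open>n\<close>-th element of \<open>F\<close>.\<close>
  define \<alpha> where "\<alpha> = (\<lambda>x. if x \<in> D then Some (enumerate F (inv_into UNIV (enumerate D) x)) else None)"
  have eq: "\<alpha> (enumerate D n) = Some (enumerate F n)" for n
    using inf by (simp add: \<alpha>_def enumerate_in_set inj_enumerate)
  have index: "\<exists>n. x = enumerate D n \<and> a = enumerate F n" if "\<alpha> x = Some a" for x a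
    using that eq enumerate_Ex[OF inf(1)] unfolding \<alpha>_def by (metis eq option.distinct(1) option.inject that)
  have dom: "dom \<alpha> = D"
    by (auto simp: \<alpha>_def split: if_splits)
  have ran: "ran \<alpha> = F"
    using index enumerate_in_set[OF inf(2)] eq enumerate_Ex[OF inf(2)] unfolding ran_def by fast
  have "a < b" if "\<alpha> x = Some a" "\<alpha> y = Some b" "x < y" for x y a b
    using index[OF that(1)] index[OF that(2)] that(3) inf by auto
  then have "\<alpha> \<in> cofin_mono_maps"
    using D F dom ran by (auto simp: cofin_mono_maps_iff)
  with dom ran show ?thesis
    by blast
qed

section \<open>Products of cofinite monotone maps\<close>

lemma dom_map_comp_subset: "dom (\<beta> \<circ>\<^sub>m \<alpha>) \<subseteq> dom \<alpha>"
  by (auto simp: map_comp_def split: option.splits)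

lemma ran_map_comp_subset: "ran (\<beta> \<circ>\<^sub>m \<alpha>) \<subseteq> ran \<beta>"
  by (auto simp: map_comp_def ran_def split: option.splits)

lemma dom_map_comp_eq: "ran \<alpha> \<subseteq> dom \<beta> \<Longrightarrow> dom (\<beta> \<circ>\<^sub>m \<alpha>) = dom \<alpha>"
  by (fastforce simp: map_comp_def ran_def split: option.splits)

lemma ran_map_comp_eq: "dom \<beta> \<subseteq> ran \<alpha> \<Longrightarrow> ran (\<beta> \<circ>\<^sub>m \<alpha>) = ran \<beta>"
  by (fastforce simp: map_comp_def ran_def split: option.splits)

text \<open>
  A point that leaves the domain of the product is a point outside \<open>dom \<alpha>\<close> or the unique preimage
  under \<open>\<alpha>\<close> of a point outside \<open>dom \<beta>\<close>; a point that leaves the range is outside \<open>ran \<beta>\<close> or the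
  image under \<open>\<beta>\<close> of a point outside \<open>ran \<alpha>\<close>. There are finitely many of each.
\<close>

lemma cofin_mono_maps_comp:
  assumes \<alpha>: "\<alpha> \<in> cofin_mono_maps" and \<beta>: "\<beta> \<in> cofin_mono_maps"
  shows "\<beta> \<circ>\<^sub>m \<alpha> \<in> cofin_mono_maps"
proof -
  note cof = cofin_mono_maps_dom[OF \<alpha>] cofin_mono_maps_ran[OF \<alpha>]
    cofin_mono_maps_dom[OF \<beta>] cofin_mono_maps_ran[OF \<beta>]
  have "finite (\<alpha> -` Some ` (pos_nats - dom \<beta>) \<inter> dom \<alpha>)"
    using \<alpha> cof by (intro finite_vimage_IntI) (auto simp: cofinite_pos_def cofin_mono_maps_def)
  moreover have "pos_nats - dom (\<beta> \<circ>\<^sub>m \<alpha>)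
      \<subseteq> (pos_nats - dom \<alpha>) \<union> (\<alpha> -` Some ` (pos_nats - dom \<beta>) \<inter> dom \<alpha>)"
    using cof(2) by (fastforce simp: cofinite_pos_def map_comp_def ran_def split: option.splits)
  ultimately have "finite (pos_nats - dom (\<beta> \<circ>\<^sub>m \<alpha>))"
    using cof(1) by (meson cofinite_pos_def finite_UnI finite_subset)
  then have "cofinite_pos (dom (\<beta> \<circ>\<^sub>m \<alpha>))"
    using cof(1) dom_map_comp_subset[of \<beta> \<alpha>] by (auto simp: cofinite_pos_def)
  moreover have "cofinite_pos (ran (\<beta> \<circ>\<^sub>m \<alpha>))"
  proof -
    have "pos_nats - ran (\<beta> \<circ>\<^sub>m \<alpha>)
        \<subseteq> (pos_nats - ran \<beta>) \<union> (\<lambda>y. the (\<beta> y)) ` (pos_nats - ran \<alpha>)"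
    proof
      fix z assume z: "z \<in> pos_nats - ran (\<beta> \<circ>\<^sub>m \<alpha>)"
      show "z \<in> (pos_nats - ran \<beta>) \<union> (\<lambda>y. the (\<beta> y)) ` (pos_nats - ran \<alpha>)"
      proof (cases "z \<in> ran \<beta>")
        case True
        then obtain y where y: "\<beta> y = Some z"
          by (auto simp: ran_def)
        have "y \<notin> ran \<alpha>"
          using z y by (auto simp: ran_def map_comp_def split: option.splits)
        moreover have "y \<in> pos_nats"
          using y cof(3) by (auto simp: cofinite_pos_def)
        ultimately show ?thesis
          using y by force
      qed (use z in auto)
    qed
    moreover have "finite ((pos_nats - ran \<beta>) \<union> (\<lambda>y. the (\<beta> y)) ` (pos_nats - ran \<alpha>))"
      using cof by (auto simp: cofinite_pos_def)
    ultimately show ?thesis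
      using cof(4) ran_map_comp_subset[of \<beta> \<alpha>] finite_subset unfolding cofinite_pos_def by blast
  qed
  moreover have "a < b" if "(\<beta> \<circ>\<^sub>m \<alpha>) x = Some a" "(\<beta> \<circ>\<^sub>m \<alpha>) y = Some b" "x < y" for x y a b
    using that cofin_mono_maps_less[OF \<alpha>] cofin_mono_maps_less[OF \<beta>]
    by (auto simp: map_comp_def split: option.splits)
  ultimately show ?thesis
    unfolding cofin_mono_maps_iff by blast
qed

lemma map_comp_assoc: "(\<gamma> \<circ>\<^sub>m \<beta>) \<circ>\<^sub>m \<alpha> = \<gamma> \<circ>\<^sub>m (\<beta> \<circ>\<^sub>m \<alpha>)"
  by (auto simp: map_comp_def split: option.splits)

lemma is_semigroup_cofin_mono: "is_semigroup cofin_mono"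
  by (simp add: is_semigroup_def cofin_mono_maps_comp map_comp_assoc)

section \<open>Ideals and Green's relations\<close>

text \<open>
  The quotient of two elements with a common domain or range is the transport map between the two
  sets in which they differ; the product has the right domain and range, hence is the right element.
\<close>

lemma ex_right_factor:
  assumes "\<alpha> \<in> cofin_mono_maps" "\<beta> \<in> cofin_mono_maps" "dom \<alpha> = dom \<beta>"
  shows "\<exists>\<sigma>\<in>cofin_mono_maps. \<beta> = \<sigma> \<circ>\<^sub>m \<alpha>"
proof -
  obtain \<sigma> where \<sigma>: "\<sigma> \<in> cofin_mono_maps" "dom \<sigma> = ran \<alpha>" "ran \<sigma> = ran \<beta>"
    using exists_transport assms by (meson cofin_mono_maps_ran)
  have "\<beta> = \<sigma> \<circ>\<^sub>m \<alpha>"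
    using assms \<sigma> by (intro cofin_mono_maps_eqI)
      (simp_all add: cofin_mono_maps_comp dom_map_comp_eq ran_map_comp_eq)
  with \<sigma> show ?thesis
    by blast
qed

lemma ex_left_factor:
  assumes "\<alpha> \<in> cofin_mono_maps" "\<beta> \<in> cofin_mono_maps" "ran \<alpha> = ran \<beta>"
  shows "\<exists>\<sigma>\<in>cofin_mono_maps. \<beta> = \<alpha> \<circ>\<^sub>m \<sigma>"
proof -
  obtain \<sigma> where \<sigma>: "\<sigma> \<in> cofin_mono_maps" "dom \<sigma> = dom \<beta>" "ran \<sigma> = dom \<alpha>"
    using exists_transport assms by (meson cofin_mono_maps_dom)
  have "\<beta> = \<alpha> \<circ>\<^sub>m \<sigma>"
    using assms \<sigma> by (intro cofin_mono_maps_eqI)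
      (simp_all add: cofin_mono_maps_comp dom_map_comp_eq ran_map_comp_eq)
  with \<sigma> show ?thesis
    by blast
qed

lemma green_R_cofin_mono:
  assumes \<alpha>: "\<alpha> \<in> cofin_mono_maps" and \<beta>: "\<beta> \<in> cofin_mono_maps"
  shows "(\<alpha>, \<beta>) \<in> green_R cofin_mono \<longleftrightarrow> dom \<alpha> = dom \<beta>"
proof
  have dom_le: "dom \<psi> \<subseteq> dom \<phi>" if "\<psi> \<in> right_ideal_gen cofin_mono \<phi>" for \<phi> \<psi>
    using that unfolding right_ideal_gen_def mult_cofin_mono
    by (metis dom_map_comp_subset imageE insertE order_refl)
  assume "(\<alpha>, \<beta>) \<in> green_R cofin_mono"
  then have "right_ideal_gen cofin_mono \<alpha> = right_ideal_gen cofin_mono \<beta>"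
    by (simp add: green_R_def)
  then have "\<beta> \<in> right_ideal_gen cofin_mono \<alpha>" "\<alpha> \<in> right_ideal_gen cofin_mono \<beta>"
    by (auto simp: right_ideal_gen_def)
  then show "dom \<alpha> = dom \<beta>"
    using dom_le by blast
next
  have le: "right_ideal_gen cofin_mono \<psi> \<subseteq> right_ideal_gen cofin_mono \<phi>"
    if \<phi>: "\<phi> \<in> cofin_mono_maps" and \<psi>: "\<psi> \<in> cofin_mono_maps" and eq: "dom \<phi> = dom \<psi>" for \<phi> \<psi>
  proof -
    obtain \<sigma> where "\<sigma> \<in> cofin_mono_maps" "\<psi> = \<sigma> \<circ>\<^sub>m \<phi>"
      using ex_right_factor[OF \<phi> \<psi> eq] by blast
    then show ?thesis
      by (auto simp: right_ideal_gen_def cofin_mono_maps_comp simp flip: map_comp_assoc)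
  qed
  assume "dom \<alpha> = dom \<beta>"
  then have "right_ideal_gen cofin_mono \<alpha> = right_ideal_gen cofin_mono \<beta>"
    using le[OF \<alpha> \<beta>] le[OF \<beta> \<alpha>] by blast
  then show "(\<alpha>, \<beta>) \<in> green_R cofin_mono"
    using \<alpha> \<beta> by (simp add: green_R_def)
qed

lemma green_L_cofin_mono:
  assumes \<alpha>: "\<alpha> \<in> cofin_mono_maps" and \<beta>: "\<beta> \<in> cofin_mono_maps"
  shows "(\<alpha>, \<beta>) \<in> green_L cofin_mono \<longleftrightarrow> ran \<alpha> = ran \<beta>"
proof
  have ran_le: "ran \<psi> \<subseteq> ran \<phi>" if "\<psi> \<in> left_ideal_gen cofin_mono \<phi>" for \<phi> \<psi>
    using that ran_map_comp_subset[of \<phi>] by (auto simp: left_ideal_gen_def)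
  assume "(\<alpha>, \<beta>) \<in> green_L cofin_mono"
  then have "left_ideal_gen cofin_mono \<alpha> = left_ideal_gen cofin_mono \<beta>"
    by (simp add: green_L_def)
  then have "\<beta> \<in> left_ideal_gen cofin_mono \<alpha>" "\<alpha> \<in> left_ideal_gen cofin_mono \<beta>"
    by (auto simp: left_ideal_gen_def)
  then show "ran \<alpha> = ran \<beta>"
    using ran_le by blast
next
  have le: "left_ideal_gen cofin_mono \<psi> \<subseteq> left_ideal_gen cofin_mono \<phi>"
    if \<phi>: "\<phi> \<in> cofin_mono_maps" and \<psi>: "\<psi> \<in> cofin_mono_maps" and eq: "ran \<phi> = ran \<psi>" for \<phi> \<psi>
  proof -
    obtain \<sigma> where "\<sigma> \<in> cofin_mono_maps" "\<psi> = \<phi> \<circ>\<^sub>m \<sigma>"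
      using ex_left_factor[OF \<phi> \<psi> eq] by blast
    then show ?thesis
      by (auto simp: left_ideal_gen_def cofin_mono_maps_comp map_comp_assoc)
  qed
  assume "ran \<alpha> = ran \<beta>"
  then have "left_ideal_gen cofin_mono \<alpha> = left_ideal_gen cofin_mono \<beta>"
    using le[OF \<alpha> \<beta>] le[OF \<beta> \<alpha>] by blast
  then show "(\<alpha>, \<beta>) \<in> green_L cofin_mono"
    using \<alpha> \<beta> by (simp add: green_L_def)
qed

lemma green_H_cofin_mono:
  assumes "\<alpha> \<in> cofin_mono_maps" "\<beta> \<in> cofin_mono_maps"
  shows "(\<alpha>, \<beta>) \<in> green_H cofin_mono \<longleftrightarrow> \<alpha> = \<beta>"
  using assms cofin_mono_maps_eqI
  by (auto simp: green_H_def green_R_cofin_mono green_L_cofin_mono)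

lemma green_D_cofin_mono: "green_D cofin_mono = cofin_mono_maps \<times> cofin_mono_maps"
proof
  show "green_D cofin_mono \<subseteq> cofin_mono_maps \<times> cofin_mono_maps"
    by (auto simp: green_D_def green_R_def green_L_def)
  show "cofin_mono_maps \<times> cofin_mono_maps \<subseteq> green_D cofin_mono"
  proof clarify
    fix \<alpha> \<beta> assume maps: "\<alpha> \<in> cofin_mono_maps" "\<beta> \<in> cofin_mono_maps"
    then obtain \<gamma> where \<gamma>: "\<gamma> \<in> cofin_mono_maps" "dom \<gamma> = dom \<alpha>" "ran \<gamma> = ran \<beta>"
      using exists_transport by (meson cofin_mono_maps_dom cofin_mono_maps_ran)
    then have "(\<alpha>, \<gamma>) \<in> green_R cofin_mono" "(\<gamma>, \<beta>) \<in> green_L cofin_mono"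
      using maps by (simp_all add: green_R_cofin_mono green_L_cofin_mono)
    then show "(\<alpha>, \<beta>) \<in> green_D cofin_mono"
      by (auto simp: green_D_def)
  qed
qed

lemma bisimple_semigroup_cofin_mono: "bisimple_semigroup cofin_mono"
proof -
  have "cofin_mono_maps \<noteq> {}"
    using exists_transport cofinite_pos_Diff[OF finite.emptyI] by blast
  then have "carrier cofin_mono // green_D cofin_mono = {cofin_mono_maps}"
    by (auto simp: quotient_def green_D_cofin_mono)
  then show ?thesis
    by (simp add: bisimple_semigroup_def is_semigroup_cofin_mono)
qed

lemma simple_semigroup_cofin_mono: "simple_semigroup cofin_mono"
  unfolding simple_semigroup_def
proof (intro conjI allI impI)
  fix I assume I: "two_sided_ideal cofin_mono I"
  then obtain \<alpha> where \<alpha>: "\<alpha> \<in> I" "\<alpha> \<in> cofin_mono_maps"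
    by (auto simp: two_sided_ideal_def)
  have "\<beta> \<in> I" if \<beta>: "\<beta> \<in> cofin_mono_maps" for \<beta>
  proof -
    obtain \<gamma> where \<gamma>: "\<gamma> \<in> cofin_mono_maps" "dom \<gamma> = dom \<alpha>" "ran \<gamma> = ran \<beta>"
      using exists_transport \<alpha> \<beta> by (meson cofin_mono_maps_dom cofin_mono_maps_ran)
    obtain \<sigma> where "\<sigma> \<in> cofin_mono_maps" "\<gamma> = \<sigma> \<circ>\<^sub>m \<alpha>"
      using ex_right_factor \<alpha> \<gamma> by metis
    then have "\<gamma> \<in> I"
      using I \<alpha> by (auto simp: two_sided_ideal_def)
    moreover obtain \<tau> where "\<tau> \<in> cofin_mono_maps" "\<beta> = \<gamma> \<circ>\<^sub>m \<tau>"
      using ex_left_factor \<beta> \<gamma> by metis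
    ultimately show ?thesis
      using I by (auto simp: two_sided_ideal_def)
  qed
  then show "I = carrier cofin_mono"
    using I by (auto simp: two_sided_ideal_def)
qed (rule is_semigroup_cofin_mono)

section \<open>Idempotents\<close>

lemma ran_restrict_Some [simp]: "ran (Some |` D) = D"
  by (auto simp: ran_def restrict_map_def)

lemma dom_restrict_Some [simp]: "dom (Some |` D) = D"
  by (auto simp: restrict_map_def split: if_splits)

lemma restrict_Some_comp: "Some |` D \<circ>\<^sub>m Some |` F = Some |` (D \<inter> F)"
  by (auto simp: map_comp_def restrict_map_def)

lemma restrict_Some_eq_iff [simp]: "Some |` D = Some |` F \<longleftrightarrow> D = F"
  by (metis ran_restrict_Some)

text \<open>If \<open>\<epsilon>\<close> is idempotent, then \<open>\<epsilon>\<close> maps \<open>x\<close> and its image to the same point; injectivity forces \<open>x\<close> to be fixed.\<close>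

lemma idempotents_cofin_mono: "idempotents cofin_mono = (\<lambda>D. Some |` D) ` Collect cofinite_pos"
proof (intro equalityI subsetI)
  fix \<epsilon> assume "\<epsilon> \<in> idempotents cofin_mono"
  then have \<epsilon>: "\<epsilon> \<in> cofin_mono_maps" "\<epsilon> \<circ>\<^sub>m \<epsilon> = \<epsilon>"
    by (auto simp: idempotents_def)
  have "\<epsilon> x = Some x" if x: "x \<in> dom \<epsilon>" for x
  proof -
    obtain y where y: "\<epsilon> x = Some y"
      using x by blast
    then have "\<epsilon> y = Some y"
      using fun_cong[OF \<epsilon>(2), of x] by simp
    with y show ?thesis
      using cofin_mono_maps_inj[OF \<epsilon>(1)] by blast
  qed
  then have "\<epsilon> = Some |` dom \<epsilon>"
    by (auto simp: restrict_map_def)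
  then show "\<epsilon> \<in> (\<lambda>D. Some |` D) ` Collect cofinite_pos"
    using cofin_mono_maps_dom[OF \<epsilon>(1)] by blast
next
  fix \<epsilon> :: "nat \<rightharpoonup> nat" assume "\<epsilon> \<in> (\<lambda>D. Some |` D) ` Collect cofinite_pos"
  then show "\<epsilon> \<in> idempotents cofin_mono"
    by (auto simp: idempotents_def restrict_Some_comp cofin_mono_maps_iff)
       (auto simp: restrict_map_def split: if_splits)
qed

lemma natural_le_restrict_Some:
  "natural_le cofin_mono (Some |` D) (Some |` F) \<longleftrightarrow> D \<subseteq> F"
  by (auto simp: natural_le_def restrict_Some_comp)

lemma natural_le_cofin_mono:
  assumes "\<epsilon> \<in> idempotents cofin_mono" "\<iota> \<in> idempotents cofin_mono"
  shows "natural_le cofin_mono \<epsilon> \<iota> \<longleftrightarrow> dom \<epsilon> \<subseteq> dom \<iota>"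
proof -
  obtain D F where "\<epsilon> = Some |` D" "\<iota> = Some |` F"
    using assms by (auto simp: idempotents_cofin_mono)
  then show ?thesis
    by (simp add: natural_le_restrict_Some)
qed

lemma partial_inv_eq_Some_iff:
  assumes "\<alpha> \<in> cofin_mono_maps"
  shows "partial_inv \<alpha> y = Some x \<longleftrightarrow> \<alpha> x = Some y"
proof -
  have "(THE x. \<alpha> x = Some y) = x" if "\<alpha> x = Some y" for x
    using that cofin_mono_maps_inj[OF assms] by blast
  then show ?thesis
    by (auto simp: partial_inv_def ran_def)
qed

lemma comp_partial_inv:
  assumes \<alpha>: "\<alpha> \<in> cofin_mono_maps"
  shows "partial_inv \<alpha> \<circ>\<^sub>m \<alpha> = Some |` dom \<alpha>" and "\<alpha> \<circ>\<^sub>m partial_inv \<alpha> = Some |` ran \<alpha>"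
proof -
  have inv: "partial_inv \<alpha> y = Some x" if "\<alpha> x = Some y" for x y
    using that partial_inv_eq_Some_iff[OF \<alpha>] by blast
  show "partial_inv \<alpha> \<circ>\<^sub>m \<alpha> = Some |` dom \<alpha>"
  proof
    fix x show "(partial_inv \<alpha> \<circ>\<^sub>m \<alpha>) x = (Some |` dom \<alpha>) x"
      by (cases "\<alpha> x") (auto simp: restrict_map_def dom_def inv)
  qed
  show "\<alpha> \<circ>\<^sub>m partial_inv \<alpha> = Some |` ran \<alpha>"
  proof
    fix y show "(\<alpha> \<circ>\<^sub>m partial_inv \<alpha>) y = (Some |` ran \<alpha>) y"
    proof (cases "y \<in> ran \<alpha>")
      case True
      then obtain x where "\<alpha> x = Some y"
        by (auto simp: ran_def)
      then show ?thesis
        using True by (simp add: inv restrict_map_def)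
    next
      case False
      then show ?thesis
        by (simp add: partial_inv_def restrict_map_def)
    qed
  qed
qed

lemma idempotents_connected:
  assumes "\<epsilon> \<in> idempotents cofin_mono" "\<iota> \<in> idempotents cofin_mono"
  shows "\<exists>\<alpha>\<in>carrier cofin_mono.
    \<alpha> \<otimes>\<^bsub>cofin_mono\<^esub> partial_inv \<alpha> = \<epsilon> \<and> partial_inv \<alpha> \<otimes>\<^bsub>cofin_mono\<^esub> \<alpha> = \<iota>"
proof -
  obtain D F where DF: "\<epsilon> = Some |` D" "\<iota> = Some |` F" "cofinite_pos D" "cofinite_pos F"
    using assms by (auto simp: idempotents_cofin_mono)
  then obtain \<alpha> where "\<alpha> \<in> cofin_mono_maps" "dom \<alpha> = D" "ran \<alpha> = F"
    using exists_transport by blast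
  with DF show ?thesis
    by (intro bexI[of _ \<alpha>]) (simp_all add: comp_partial_inv)
qed

lemma is_semilattice_idempotents: "is_semilattice idempotent_semilattice"
  by (auto simp: is_semilattice_def is_semigroup_def idempotent_semilattice_def
      idempotents_cofin_mono restrict_Some_comp cofinite_pos_Int Int_ac)

lemma is_semilattice_finite_subsets: "is_semilattice finite_subsets_semilattice"
  by (auto simp: is_semilattice_def is_semigroup_def finite_subsets_semilattice_def)

lemma bij_betw_complement_dom:
  "bij_betw (\<lambda>\<epsilon>. pos_nats - dom \<epsilon>) (idempotents cofin_mono) {A. A \<subseteq> pos_nats \<and> finite A}"
  by (rule bij_betw_byWitness[where f' = "\<lambda>A. Some |` (pos_nats - A)"])
     (auto simp: idempotents_cofin_mono cofinite_pos_def double_diff Diff_Diff_Int)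

lemma complement_dom_iso:
  "(\<lambda>\<epsilon>. pos_nats - dom \<epsilon>) \<in> iso idempotent_semilattice finite_subsets_semilattice"
  unfolding iso_def hom_def
  using bij_betw_complement_dom
  by (auto simp: idempotent_semilattice_def finite_subsets_semilattice_def
      idempotents_cofin_mono restrict_Some_comp cofinite_pos_def)

text \<open>
  Taking complements of domains reverses inclusion, so it carries a maximal chain of idempotents to
  a maximal chain of finite sets, where larger cardinality means lower in the natural order.
\<close>

lemma maxchain_idempotents_is_omega_chain:
  assumes max: "pred_on.maxchain (idempotents cofin_mono) (natural_le cofin_mono) C"
  shows "is_omega_chain cofin_mono C"
proof -
  let ?E = "idempotents cofin_mono" and ?c = "\<lambda>\<epsilon> :: nat \<rightharpoonup> nat. pos_nats - dom \<epsilon>"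
  have chain: "pred_on.chain ?E (natural_le cofin_mono) C"
    using max by (simp add: pred_on.maxchain_def)
  then have CE: "C \<subseteq> ?E"
    by (simp add: pred_on.chain_def)
  have le_iff: "natural_le cofin_mono \<epsilon> \<iota> \<longleftrightarrow> ?c \<iota> \<subseteq> ?c \<epsilon>" if "\<epsilon> \<in> ?E" "\<iota> \<in> ?E" for \<epsilon> \<iota>
  proof -
    have "dom \<epsilon> \<subseteq> pos_nats"
      using that(1) cofin_mono_maps_dom by (simp add: idempotents_def cofinite_pos_def)
    then show ?thesis
      unfolding natural_le_cofin_mono[OF that] by blast
  qed
  have comparable: "?c \<epsilon> \<subseteq> ?c \<iota> \<or> ?c \<iota> \<subseteq> ?c \<epsilon>" if "\<epsilon> \<in> C" "\<iota> \<in> C" for \<epsilon> \<iota>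
  proof -
    have "natural_le cofin_mono \<epsilon> \<iota> \<or> natural_le cofin_mono \<iota> \<epsilon> \<or> \<epsilon> = \<iota>"
      using chain that by (auto simp: pred_on.chain_def)
    moreover have "\<epsilon> \<in> ?E" "\<iota> \<in> ?E"
      using that CE by auto
    ultimately show ?thesis
      using le_iff by blast
  qed
  have fin: "?c \<epsilon> \<subseteq> pos_nats \<and> finite (?c \<epsilon>)" if "\<epsilon> \<in> ?E" for \<epsilon>
    using bij_betwE[OF bij_betw_complement_dom] that by blast
  have "bij_betw card (?c ` C) UNIV"
  proof (rule bij_betw_card_maximal_chain[OF infinite_pos_nats])
    fix A assume A: "A \<subseteq> pos_nats" "finite A"
      and comp: "\<And>B. B \<in> ?c ` C \<Longrightarrow> A \<subseteq> B \<or> B \<subseteq> A"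
    have "A \<in> ?c ` ?E"
      using A bij_betw_imp_surj_on[OF bij_betw_complement_dom] by simp
    then obtain \<epsilon> where \<epsilon>: "\<epsilon> \<in> ?E" "?c \<epsilon> = A"
      by auto
    have "natural_le cofin_mono \<epsilon> \<iota> \<or> natural_le cofin_mono \<iota> \<epsilon>" if "\<iota> \<in> C" for \<iota>
    proof -
      have "A \<subseteq> ?c \<iota> \<or> ?c \<iota> \<subseteq> A"
        using that by (intro comp imageI)
      then show ?thesis
        using le_iff[of \<epsilon> \<iota>] le_iff[of \<iota> \<epsilon>] \<epsilon> that CE by auto
    qed
    then have "pred_on.chain ?E (natural_le cofin_mono) (insert \<epsilon> C)"
      using chain \<epsilon> by (auto simp: pred_on.chain_def)
    then have "\<epsilon> \<in> C"
      using max by (auto simp: pred_on.maxchain_def)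
    with \<epsilon> show "A \<in> ?c ` C"
      by blast
  next
    fix A B assume "A \<in> ?c ` C" "B \<in> ?c ` C"
    then show "A \<subseteq> B \<or> B \<subseteq> A"
      by (elim imageE) (simp only: comparable)
  qed (use fin CE in auto)
  moreover have "bij_betw ?c C (?c ` C)"
    using bij_betw_complement_dom CE by (meson bij_betw_subset)
  moreover have "bij_betw (\<lambda>n. - int n) UNIV {k. k \<le> 0}"
    by (rule bij_betw_byWitness[where f' = "\<lambda>k. nat (- k)"]) auto
  ultimately have "bij_betw ((\<lambda>n. - int n) \<circ> (card \<circ> ?c)) C {k. k \<le> 0}"
    by (intro bij_betw_trans)
  moreover have "natural_le cofin_mono \<epsilon> \<iota> \<longleftrightarrow> - int (card (?c \<epsilon>)) \<le> - int (card (?c \<iota>))"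
    if "\<epsilon> \<in> C" "\<iota> \<in> C" for \<epsilon> \<iota>
  proof -
    have "?c \<iota> \<subseteq> ?c \<epsilon> \<longleftrightarrow> card (?c \<iota>) \<le> card (?c \<epsilon>)"
    proof
      show "?c \<iota> \<subseteq> ?c \<epsilon> \<Longrightarrow> card (?c \<iota>) \<le> card (?c \<epsilon>)"
        using fin that CE by (intro card_mono) auto
      show "?c \<iota> \<subseteq> ?c \<epsilon>" if "card (?c \<iota>) \<le> card (?c \<epsilon>)"
        using comparable[OF \<open>\<epsilon> \<in> C\<close> \<open>\<iota> \<in> C\<close>]
      proof
        assume "?c \<epsilon> \<subseteq> ?c \<iota>"
        then have "?c \<epsilon> = ?c \<iota>"
          using fin \<open>\<iota> \<in> C\<close> CE that by (intro card_seteq) auto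
        then show ?thesis
          by simp
      qed
    qed
    then show ?thesis
      using le_iff that CE by (simp add: subset_iff)
  qed
  ultimately show ?thesis
    unfolding is_omega_chain_def using chain
    by (intro conjI exI[of _ "(\<lambda>n. - int n) \<circ> (card \<circ> ?c)"]) auto
qed

theorem proposition2p1:
  "simple_semigroup cofin_mono \<and>
   (\<forall>\<alpha>\<in>carrier cofin_mono. \<forall>\<beta>\<in>carrier cofin_mono.
      ((\<alpha>, \<beta>) \<in> green_R cofin_mono \<longleftrightarrow> dom \<alpha> = dom \<beta>) \<and>
      ((\<alpha>, \<beta>) \<in> green_L cofin_mono \<longleftrightarrow> ran \<alpha> = ran \<beta>)) \<and>
   (\<forall>\<alpha>\<in>carrier cofin_mono. \<forall>\<beta>\<in>carrier cofin_mono.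
      (\<alpha>, \<beta>) \<in> green_H cofin_mono \<longleftrightarrow> \<alpha> = \<beta>) \<and>
   (\<forall>\<epsilon>\<in>idempotents cofin_mono. \<forall>\<iota>\<in>idempotents cofin_mono.
      \<exists>\<alpha>\<in>carrier cofin_mono.
        \<alpha> \<otimes>\<^bsub>cofin_mono\<^esub> partial_inv \<alpha> = \<epsilon> \<and> partial_inv \<alpha> \<otimes>\<^bsub>cofin_mono\<^esub> \<alpha> = \<iota>) \<and>
   bisimple_semigroup cofin_mono \<and>
   (\<forall>\<epsilon>\<in>idempotents cofin_mono. \<forall>\<iota>\<in>idempotents cofin_mono.
      natural_le cofin_mono \<epsilon> \<iota> \<longleftrightarrow> dom \<epsilon> \<subseteq> dom \<iota>) \<and>
   (is_semilattice idempotent_semilattice \<and>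
    is_semilattice finite_subsets_semilattice \<and>
    (\<lambda>\<epsilon>. pos_nats - dom \<epsilon>) \<in> iso idempotent_semilattice finite_subsets_semilattice) \<and>
   (\<forall>C. pred_on.maxchain (idempotents cofin_mono) (natural_le cofin_mono) C \<longrightarrow>
        is_omega_chain cofin_mono C)"
  by (intro conjI ballI allI impI)
     (simp_all only: carrier_cofin_mono simple_semigroup_cofin_mono green_R_cofin_mono
       green_L_cofin_mono green_H_cofin_mono idempotents_connected[unfolded carrier_cofin_mono]
       bisimple_semigroup_cofin_mono natural_le_cofin_mono is_semilattice_idempotents
       is_semilattice_finite_subsets complement_dom_iso maxchain_idempotents_is_omega_chain)

end
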